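(* Let $\mathcal{A} \in \mathbb{R}^{n\times\cdots\times n}$ be an antisymmetric tensor of order $d$. Then the multilinear rank $r$ of $\mathcal{A}$ satisfies $r = 0$ or $r = d$ or $d+2 \le r \le n$. Any of these ranks can be attained.
   Context: A tensor $\mathcal{A} \in \mathbb{R}^{n\times\cdots\times n}$ of order $d\ge 2$ (a real array with entries $\mathcal{A}(i_1,\ldots,i_d)$, $1\le i_\mu\le n$) is called antisymmetric if its entries change sign when permuting pairs of indices. For $1\le\mu\le d$, the $\mu$th matricization $\mathbf{A}_{(\mu)}$ is the $n\times n^{d-1}$ matrix whose rows are indexed by $i_\mu$ and whose columns are indexed by the remaining indices $(i_\nu)_{\nu\ne\mu}$, with the entry $\mathcal{A}(i_1,\ldots,i_d)$ in the corresponding position. For an antisymmetric tensor all matricizations coincide up to sign, so they have the same rank $r$; this common value $r = \operatorname{rank}(\mathbf{A}_{(1)})$ is called the multilinear rank of $\mathcal{A}$.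
   Formalization: Attainability is claimed only for even r when d = 2, since a real skew-symmetric matrix has even rank (so r = n = 5 is impossible), and r = d is claimed attainable only when d ≤ n, since the rank cannot exceed n. *)

theory Defs
  imports "Jordan_Normal_Form.DL_Rank"
begin

text \<open>
  A real tensor of order \<open>d\<close> and size \<open>n \<times> \<dots> \<times> n\<close> is represented by a function
  on index lists, of which only the values at lists in \<open>tensor_indices d n\<close> matter.
  Indices are 0-based, so they range over \<open>{0..<n}\<close>, and modes over \<open>{0..<d}\<close>.
\<close>

definition tensor_indices :: "nat \<Rightarrow> nat \<Rightarrow> nat list set" where
  "tensor_indices d n = {is. length is = d \<and> set is \<subseteq> {0..<n}}"

definition antisymmetric_tensor :: "nat \<Rightarrow> nat \<Rightarrow> (nat list \<Rightarrow> real) \<Rightarrow> bool" where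
  "antisymmetric_tensor d n A \<longleftrightarrow>
     (\<forall>is \<in> tensor_indices d n. \<forall>p<d. \<forall>q<d. p \<noteq> q \<longrightarrow>
        A (is[p := is ! q, q := is ! p]) = - A is)"

text \<open>
  The \<open>n ^ (d - 1)\<close> columns of a matricization are indexed by the lists of the remaining
  \<open>d - 1\<close> indices, enumerated as in \<^term>\<open>List.n_lists (d - 1) [0..<n]\<close>; the order of
  enumeration only permutes columns. The row index is inserted at position \<open>\<mu>\<close>.
\<close>

definition matricization :: "nat \<Rightarrow> nat \<Rightarrow> nat \<Rightarrow> (nat list \<Rightarrow> real) \<Rightarrow> real mat" where
  "matricization d n \<mu> A =
     mat n (n ^ (d - 1))
       (\<lambda>(i, j). let js = List.n_lists (d - 1) [0..<n] ! j in A (take \<mu> js @ i # drop \<mu> js))"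

text \<open>
  For an antisymmetric tensor the matricizations agree up to sign, so the rank of the first
  one is the common rank of all of them.
\<close>

definition multilinear_rank :: "nat \<Rightarrow> nat \<Rightarrow> (nat list \<Rightarrow> real) \<Rightarrow> nat" where
  "multilinear_rank d n A = vec_space.rank n (matricization d n 0 A)"

end

theory Submission
  imports Defs
begin

text \<open>
  Let \<open>S\<close> be a set of row indices whose rows form a basis of the row space of the first
  matricization, so that \<open>card S = r\<close>. Since every mode can be swapped into the first one, a
  linear relation among the rows in \<open>S\<close> need only be checked on columns with indices in \<open>S\<close>.
  If \<open>r < d\<close>, every entry with indices in \<open>S\<close> has a repeated index, so \<open>S\<close> is empty.
  If \<open>r = d + 1\<close>, the Hodge dual \<open>x\<close> of the tensor on \<open>S\<close> (a vector, since the orders \<open>d\<close> and \<open>1\<close>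
  are complementary) is a nontrivial relation: a column \<open>J\<close> with distinct indices misses exactly
  two elements \<open>y\<close>, \<open>z\<close> of \<open>S\<close>, and the two remaining terms of the relation cancel.

  Conversely, the sum of the elementary antisymmetric tensors of \<open>d\<close>-sets that pairwise share at
  most \<open>d - 2\<close> elements has as its rank the size of their union. Such families are enlarged by a
  set with \<open>2\<close> or \<open>3\<close> new elements, which reaches all admissible sizes.
\<close>


section \<open>Linear algebra: row bases and matrix rank\<close>

text \<open>Gaussian elimination, one equation per induction step. It is applied twice below to
  compare the sizes of a row basis and a column basis.\<close>

lemma underdetermined_system:
  fixes a :: "'e \<Rightarrow> 'i \<Rightarrow> real"
  assumes "finite E" "finite I" "card E < card I"
  shows "\<exists>x. (\<exists>i\<in>I. x i \<noteq> 0) \<and> (\<forall>e\<in>E. (\<Sum>i\<in>I. x i * a e i) = 0)"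
  using assms
proof (induction E arbitrary: I a rule: finite_induct)
  case empty
  then have "I \<noteq> {}" by auto
  then show ?case by (intro exI[of _ "\<lambda>_. 1"]) auto
next
  case (insert e E)
  show ?case
  proof (cases "\<forall>i\<in>I. a e i = 0")
    case True
    have "card E < card I" using insert by simp
    then obtain x where x: "\<exists>i\<in>I. x i \<noteq> 0" "\<forall>e\<in>E. (\<Sum>i\<in>I. x i * a e i) = 0"
      using insert.IH[OF insert.prems(1), of a] by blast
    then show ?thesis using True by (intro exI[of _ x]) simp
  next
    case False
    then obtain i0 where i0: "i0 \<in> I" "a e i0 \<noteq> 0" by blast
    define I' where "I' = I - {i0}"
    have I': "I = insert i0 I'" "i0 \<notin> I'" "finite I'" using i0 insert.prems by (auto simp: I'_def)
    have "card E < card I'" using insert I' by simp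
    \<comment> \<open>The coefficients are those left after eliminating the unknown
      \<open>i0\<close> by means of equation \<open>e\<close>.\<close>
    then obtain x where x: "\<exists>i\<in>I'. x i \<noteq> 0"
        "\<forall>e'\<in>E. (\<Sum>i\<in>I'. x i * (a e' i - a e' i0 * a e i / a e i0)) = 0"
      using insert.IH[OF I'(3), of "\<lambda>e' i. a e' i - a e' i0 * a e i / a e i0"] by blast
    \<comment> \<open>Back substitution: the value of the unknown \<open>i0\<close> that makes
      equation \<open>e\<close> hold.\<close>
    define t where "t = - (\<Sum>i\<in>I'. x i * a e i) / a e i0"
    have sum: "(\<Sum>i\<in>I. (x(i0 := t)) i * b i) = t * b i0 + (\<Sum>i\<in>I'. x i * b i)" for b
    proof -
      have "(\<Sum>i\<in>I'. (x(i0 := t)) i * b i) = (\<Sum>i\<in>I'. x i * b i)"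
        using I' by (intro sum.cong) auto
      then show ?thesis unfolding I'(1) using I'(2,3) by (subst sum.insert) auto
    qed
    have "t * a e' i0 + (\<Sum>i\<in>I'. x i * a e' i) = 0" if "e' \<in> E" for e'
    proof -
      have "0 = (\<Sum>i\<in>I'. x i * a e' i - a e' i0 / a e i0 * (x i * a e i))"
        using x(2)[rule_format, OF that] by (simp add: right_diff_distrib mult_ac)
      also have "\<dots> = (\<Sum>i\<in>I'. x i * a e' i) - a e' i0 / a e i0 * (\<Sum>i\<in>I'. x i * a e i)"
        by (simp add: sum_subtractf sum_distrib_left)
      finally show ?thesis by (simp add: t_def)
    qed
    moreover have "t * a e i0 + (\<Sum>i\<in>I'. x i * a e i) = 0"
      using i0 by (simp add: t_def)
    ultimately have "\<forall>e'\<in>insert e E. (\<Sum>i\<in>I. (x(i0 := t)) i * a e' i) = 0"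
      unfolding sum by blast
    moreover have "\<exists>i\<in>I. (x(i0 := t)) i \<noteq> 0"
      using x(1) I' by (metis fun_upd_apply insertCI)
    ultimately show ?thesis by blast
  qed
qed

text \<open>Row indices are selected instead of row vectors, so that the same \<open>S\<close> can
  later constrain the column indices. The type of \<open>X\<close> is free because columns are
  numbered by naturals in a matrix and by index lists in a tensor.\<close>

definition row_basis :: "nat \<Rightarrow> 'a set \<Rightarrow> (nat \<Rightarrow> 'a \<Rightarrow> real) \<Rightarrow> nat set \<Rightarrow> bool" where
  "row_basis n X f S \<longleftrightarrow> S \<subseteq> {..<n} \<and>
     (\<forall>x. (\<forall>j\<in>X. (\<Sum>s\<in>S. x s * f s j) = 0) \<longrightarrow> (\<forall>s\<in>S. x s = 0)) \<and>
     (\<forall>i<n. \<exists>c. \<forall>j\<in>X. f i j = (\<Sum>s\<in>S. c s * f s j))"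

lemma row_basis_exists: "\<exists>S. row_basis n X f S"
proof -
  define P where "P S \<longleftrightarrow> S \<subseteq> {..<n} \<and>
    (\<forall>x. (\<forall>j\<in>X. (\<Sum>s\<in>S. x s * f s j) = 0) \<longrightarrow> (\<forall>s\<in>S. x s = 0))" for S
  have "P {}" by (simp add: P_def)
  moreover have "S \<subseteq> {..<n}" if "P S" for S using that by (simp add: P_def)
  ultimately obtain S where S: "finite S" "maximal S P"
    using maximal_exists_superset[of "{..<n}" P "{}"] by blast
  then have PS: "P S" by (simp add: maximal_def)
  have "\<exists>c. \<forall>j\<in>X. f i j = (\<Sum>s\<in>S. c s * f s j)" if i: "i < n" for i
  proof (cases "i \<in> S")
    case True
    then show ?thesis using S(1)
      by (intro exI[of _ "\<lambda>s. if s = i then 1 else 0"]) (simp add: if_distrib[of "\<lambda>z. z * _"] cong: if_cong)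
  next
    case False
    then have "\<not> P (insert i S)" using S(2) unfolding maximal_def by blast
    then obtain x s where x: "\<forall>j\<in>X. (\<Sum>s\<in>insert i S. x s * f s j) = 0" "s \<in> insert i S" "x s \<noteq> 0"
      using PS i by (auto simp: P_def)
    have eq: "x i * f i j = - (\<Sum>s\<in>S. x s * f s j)" if "j \<in> X" for j
      using x(1)[rule_format, OF that] False S(1) by simp
    \<comment> \<open>A relation without the new row \<open>i\<close> would be one among the rows in
      \<open>S\<close>, hence trivial; so it can be solved for row \<open>i\<close>.\<close>
    have "x i \<noteq> 0"
    proof
      assume "x i = 0"
      then have "\<forall>s\<in>S. x s = 0" using PS eq unfolding P_def by fastforce
      then show False using x \<open>x i = 0\<close> by auto
    qed
    then have "\<forall>j\<in>X. f i j = (\<Sum>s\<in>S. (- x s / x i) * f s j)"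
      using eq by (auto simp: field_simps sum_negf simp flip: sum_divide_distrib)
    then show ?thesis by (rule exI[of _ "\<lambda>s. - x s / x i"])
  qed
  then show ?thesis using PS unfolding P_def row_basis_def by blast
qed

text \<open>The rank is the size of any maximal independent set of columns, and maximality forces
  such a set to span all columns.\<close>

lemma (in vec_space) column_basis_exists:
  assumes M: "M \<in> carrier_mat n m"
  obtains U where "finite U" "U \<subseteq> set (cols M)" "lin_indpt U" "card U = rank M"
    "\<And>v. v \<in> set (cols M) \<Longrightarrow> v \<in> span U"
proof -
  let ?P = "\<lambda>T. T \<subseteq> set (cols M) \<and> lin_indpt T"
  obtain U where U: "finite U" "maximal U ?P"
    using maximal_exists_superset[of "set (cols M)" ?P "{}"] by (auto simp: lin_dep_def)
  have sub: "U \<subseteq> set (cols M)" "lin_indpt U" using U(2) by (auto simp: maximal_def)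
  have carr: "set (cols M) \<subseteq> carrier_vec n" using cols_dim M by blast
  have "v \<in> span U" if v: "v \<in> set (cols M)" for v
  proof (cases "v \<in> U")
    case True
    then show ?thesis using sub carr by (meson in_own_span subset_iff subset_trans)
  next
    case False
    then have "\<not> ?P (insert v U)" using U(2) unfolding maximal_def by blast
    then have "lin_dep (U \<union> {v})" using sub v by auto
    then show ?thesis using lin_dep_iff_in_span[of U v] sub carr v False by auto
  qed
  then show thesis using that U(1) sub rank_card_indpt[OF M U(2)] by metis
qed

text \<open>Row rank equals column rank: if one basis were larger, there would be a nontrivial
  relation among its vectors tested only against the other basis, and such a relation extends to the
  whole matrix.\<close>

lemma card_row_basis:
  fixes M :: "real mat"
  assumes M: "M \<in> carrier_mat n m" and S: "row_basis n {..<m} (\<lambda>i j. M $$ (i, j)) S"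
  shows "card S = vec_space.rank n M"
proof -
  interpret vec_space "TYPE(real)" n .
  obtain U where U: "finite U" "U \<subseteq> set (cols M)" "lin_indpt U" "card U = rank M"
    and span: "\<And>v. v \<in> set (cols M) \<Longrightarrow> v \<in> span U"
    using column_basis_exists[OF M] by blast
  have carr: "U \<subseteq> carrier_vec n" using cols_dim M U by blast
  have S': "S \<subseteq> {..<n}" "finite S"
    using S finite_subset[of S "{..<n}"] by (auto simp: row_basis_def)
  have indep: "\<forall>s\<in>S. x s = 0" if "\<forall>j<m. (\<Sum>s\<in>S. x s * M $$ (s, j)) = 0" for x
    using S that unfolding row_basis_def by blast
  have rep: "\<exists>c. \<forall>j<m. M $$ (i, j) = (\<Sum>s\<in>S. c s * M $$ (s, j))" if "i < n" for i
    using S that unfolding row_basis_def by (meson lessThan_iff)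
  have col: "\<exists>j<m. \<forall>i<n. u $ i = M $$ (i, j)" if "u \<in> U" for u
    using that U(2) M by (fastforce simp: cols_def)
  have "\<not> card S < card U"
  proof
    assume "card S < card U"
    then obtain a where a: "\<exists>u\<in>U. a u \<noteq> 0" "\<forall>s\<in>S. (\<Sum>u\<in>U. a u * u $ s) = 0"
      using underdetermined_system[OF S'(2) U(1), of "\<lambda>s u. u $ s"] by blast
    \<comment> \<open>The relation holds at the coordinates in \<open>S\<close>, and every other
      coordinate is a combination of these.\<close>
    have "(\<Sum>u\<in>U. a u * u $ i) = 0" if i: "i < n" for i
    proof -
      obtain c where c: "\<forall>j<m. M $$ (i, j) = (\<Sum>s\<in>S. c s * M $$ (s, j))" using rep[OF i] by blast
      have u: "u $ i = (\<Sum>s\<in>S. c s * u $ s)" if u: "u \<in> U" for u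
      proof -
        obtain j where "j < m" "\<forall>i<n. u $ i = M $$ (i, j)" using col[OF u] by blast
        then show ?thesis using c i S'(1) by (auto intro!: sum.cong)
      qed
      have "(\<Sum>u\<in>U. a u * u $ i) = (\<Sum>u\<in>U. \<Sum>s\<in>S. c s * (a u * u $ s))"
        by (intro sum.cong) (auto simp: u sum_distrib_left mult_ac)
      also have "\<dots> = (\<Sum>s\<in>S. c s * (\<Sum>u\<in>U. a u * u $ s))"
        by (subst sum.swap) (simp add: sum_distrib_left)
      also have "\<dots> = 0" using a(2) by simp
      finally show ?thesis .
    qed
    then have "lincomb a U = 0\<^sub>v n"
      using carr U(1) by (intro eq_vecI) (auto simp: lincomb_index lincomb_dim)
    then have "lin_dep U" using a(1) U(1) by (auto simp: lin_dep_def)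
    then show False using U(3) by blast
  qed
  moreover have "\<not> card U < card S"
  proof
    assume "card U < card S"
    then obtain x where x: "\<exists>s\<in>S. x s \<noteq> 0" "\<forall>u\<in>U. (\<Sum>s\<in>S. x s * u $ s) = 0"
      using underdetermined_system[OF U(1) S'(2), of "\<lambda>u s. u $ s"] by blast
    \<comment> \<open>The relation holds on the columns in \<open>U\<close>, and these span column
      \<open>j\<close>.\<close>
    have "(\<Sum>s\<in>S. x s * M $$ (s, j)) = 0" if j: "j < m" for j
    proof -
      have "col M j \<in> set (cols M)" using j M by (auto simp: cols_def)
      then obtain e where e: "lincomb e U = col M j"
        using span U(1) carr by (metis (no_types, lifting) finite_in_span)
      have "M $$ (s, j) = (\<Sum>u\<in>U. e u * u $ s)" if "s \<in> S" for s
        using arg_cong[OF e, of "\<lambda>v. v $ s"] that S'(1) M j carr by (auto simp: lincomb_index subset_iff)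
      then have "(\<Sum>s\<in>S. x s * M $$ (s, j)) = (\<Sum>s\<in>S. \<Sum>u\<in>U. e u * (x s * u $ s))"
        by (simp add: sum_distrib_left mult_ac)
      also have "\<dots> = (\<Sum>u\<in>U. e u * (\<Sum>s\<in>S. x s * u $ s))"
        by (subst sum.swap) (simp add: sum_distrib_left)
      finally show ?thesis using x(2) by simp
    qed
    then show False using indep x(1) by blast
  qed
  ultimately show ?thesis using U(4) by simp
qed

lemma set_n_lists_tensor_indices: "set (List.n_lists d [0..<n]) = tensor_indices d n"
  by (auto simp: set_n_lists tensor_indices_def)

text \<open>A row basis sees the columns only as an unordered family, so the enumeration by
  \<open>List.n_lists\<close> disappears here.\<close>

lemma card_tensor_row_basis:
  assumes "row_basis n (tensor_indices (d - 1) n) (\<lambda>i J. A (i # J)) S"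
  shows "card S = multilinear_rank d n A"
proof -
  let ?L = "List.n_lists (d - 1) [0..<n]" and ?M = "matricization d n 0 A"
  have M: "?M \<in> carrier_mat n (n ^ (d - 1))" by (simp add: matricization_def)
  have idx: "tensor_indices (d - 1) n = (\<lambda>j. ?L ! j) ` {..<n ^ (d - 1)}"
    unfolding set_n_lists_tensor_indices[symmetric]
    by (auto simp: set_conv_nth length_n_lists image_def)
  have entry: "?M $$ (i, j) = A (i # ?L ! j)" if "i < n" "j < n ^ (d - 1)" for i j
    using that by (simp add: matricization_def)
  have "row_basis n {..<n ^ (d - 1)} (\<lambda>i j. A (i # ?L ! j)) S"
    using assms unfolding row_basis_def idx ball_simps(9) .
  then have "row_basis n {..<n ^ (d - 1)} (\<lambda>i j. ?M $$ (i, j)) S"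
    unfolding row_basis_def by (auto simp: entry subset_iff)
  then show ?thesis using card_row_basis[OF M] by (simp add: multilinear_rank_def)
qed


section \<open>Antisymmetric tensors under permutations, and elementary ones\<close>

lemma antisymmetric_tensorD:
  assumes "antisymmetric_tensor d n A" "L \<in> tensor_indices d n" "p < d" "q < d" "p \<noteq> q"
  shows "A (L[p := L ! q, q := L ! p]) = - A L"
  using assms by (auto simp: antisymmetric_tensor_def)

text \<open>Swapping two equal indices fixes the list but changes the sign of the entry.\<close>

lemma antisymmetric_tensor_not_distinct:
  assumes A: "antisymmetric_tensor d n A" and L: "L \<in> tensor_indices d n" "\<not> distinct L"
  shows "A L = 0"
proof -
  obtain p q where pq: "p < length L" "q < length L" "p \<noteq> q" "L ! p = L ! q"
    using L(2) by (auto simp: distinct_conv_nth)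
  then have "L[p := L ! q, q := L ! p] = L" by (metis list_update_id)
  moreover have "length L = d" using L by (simp add: tensor_indices_def)
  ultimately show ?thesis using antisymmetric_tensorD[OF A L(1), of p q] pq by simp
qed

lemma permute_list_transpose:
  assumes "a < length L" "b < length L"
  shows "permute_list (Transposition.transpose a b) L = L[a := L ! b, b := L ! a]"
  using assms by (intro nth_equalityI) (auto simp: permute_list_def Transposition.transpose_def nth_list_update)

lemma antisymmetric_tensor_permute_list:
  assumes A: "antisymmetric_tensor d n A" and p: "p permutes {..<d}" and L: "L \<in> tensor_indices d n"
  shows "A (permute_list p L) = of_int (sign p) * A L"
  using p finite_lessThan L
proof (induction arbitrary: L rule: permutes_induct)
  case id
  then show ?case by simp
next
  case (swap a b p)
  have len: "length L = d" using swap.prems by (simp add: tensor_indices_def)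
  let ?L = "L[a := L ! b, b := L ! a]"
  have "?L \<in> tensor_indices d n"
    using swap.prems swap.hyps len set_swap[of a L b] by (auto simp: tensor_indices_def)
  then have "A (permute_list p ?L) = of_int (sign p) * A ?L" by (rule swap.IH)
  moreover have "A ?L = - A L"
    using antisymmetric_tensorD[OF A swap.prems] swap.hyps by simp
  moreover have "permute_list (Transposition.transpose a b \<circ> p) L = permute_list p ?L"
    using swap.hyps len by (simp add: permute_list_compose permute_list_transpose)
  moreover have "sign (Transposition.transpose a b \<circ> p) = - sign p"
    using swap.hyps permutes_imp_permutation[OF finite_lessThan]
    by (auto simp: sign_compose permutation_swap_id sign_swap_id)
  ultimately show ?case
    by (simp only: of_int_minus mult_minus_left mult_minus_right)
qed

text \<open>The factor \<open>c\<close> is the sign of the reordering and is fixed before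
  \<open>A\<close>, so two tensors reordered together pick up the same sign, which cancels in their
  product.\<close>

lemma antisymmetric_tensor_reorder:
  assumes "L \<in> tensor_indices d n" "distinct L" "distinct L'" "set L' = set L"
  obtains c :: real where "c * c = 1"
    "\<And>A. antisymmetric_tensor d n A \<Longrightarrow> A L' = c * A L"
proof -
  have len: "length L = d" using assms(1) by (simp add: tensor_indices_def)
  have "mset L' = mset L" using assms by (metis set_eq_iff_mset_eq_distinct)
  then obtain p where p: "p permutes {..<d}" "permute_list p L = L'"
    using len by (metis mset_eq_permutation)
  show thesis
  proof
    show "real_of_int (sign p) * real_of_int (sign p) = 1"
      by (simp flip: of_int_mult)
    show "A L' = real_of_int (sign p) * A L" if "antisymmetric_tensor d n A" for A
      using antisymmetric_tensor_permute_list[OF that p(1) assms(1)] p(2) by simp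
  qed
qed

lemma antisymmetric_tensor_Cons:
  assumes "antisymmetric_tensor (Suc d) n A" "y < n"
  shows "antisymmetric_tensor d n (\<lambda>L. A (y # L))"
  unfolding antisymmetric_tensor_def
proof (intro ballI allI impI)
  fix L p q assume "L \<in> tensor_indices d n" "p < d" "q < d" "p \<noteq> q"
  then show "A (y # L[p := L ! q, q := L ! p]) = - A (y # L)"
    using antisymmetric_tensorD[OF assms(1), of "y # L" "Suc p" "Suc q"] assms(2)
    by (simp add: tensor_indices_def)
qed

text \<open>
  The sign of \<open>L\<close> as an ordering of \<open>E\<close>, and \<open>0\<close> if \<open>L\<close> is no ordering of \<open>E\<close>. Writing it as a
  determinant makes antisymmetry a row exchange.
\<close>

definition edge_tensor :: "nat set \<Rightarrow> nat list \<Rightarrow> real" where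
  "edge_tensor E L = det (mat (card E) (card E)
     (\<lambda>(p, q). if L ! p = sorted_list_of_set E ! q then 1 else 0))"

lemma antisymmetric_edge_tensor: "antisymmetric_tensor (card E) n (edge_tensor E)"
  unfolding antisymmetric_tensor_def
proof (intro ballI allI impI)
  let ?k = "card E"
  let ?M = "\<lambda>L. mat ?k ?k (\<lambda>(p, q). if L ! p = sorted_list_of_set E ! q then 1 else (0::real))"
  fix L p q assume L: "L \<in> tensor_indices ?k n" "p < ?k" "q < ?k" "p \<noteq> q"
  then have "?M (L[p := L ! q, q := L ! p]) = swaprows p q (?M L)"
    by (intro eq_matI) (auto simp: tensor_indices_def nth_list_update)
  then show "edge_tensor E (L[p := L ! q, q := L ! p]) = - edge_tensor E L"
    using L by (simp add: edge_tensor_def det_swaprows)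
qed

text \<open>If \<open>L\<close> orders \<open>E\<close>, the 0/1 matrix is a permutation matrix,
  hence orthogonal; if \<open>L\<close> misses an element of \<open>E\<close>, the matching column
  is zero.\<close>

lemma edge_tensor_nonzero_iff:
  assumes "finite E" "length L = card E"
  shows "edge_tensor E L \<noteq> 0 \<longleftrightarrow> set L = E"
proof -
  define k e where "k = card E" and "e = sorted_list_of_set E"
  define M where "M = mat k k (\<lambda>(p, q). if L ! p = e ! q then 1 else (0::real))"
  have e: "set e = E" "distinct e" "length e = k" using assms(1) by (auto simp: e_def k_def)
  have M: "M \<in> carrier_mat k k" by (simp add: M_def)
  have det: "edge_tensor E L = det M" by (simp add: edge_tensor_def M_def e_def k_def)
  have idx: "\<exists>q<k. x = e ! q" if "x \<in> E" for x
    using that e in_set_conv_nth[of x e] by auto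
  have L: "length L = k" using assms(2) by (simp add: k_def)
  show ?thesis
  proof
    assume set: "set L = E"
    then have "distinct L" using assms(2) by (simp add: card_distinct)
    have "M * transpose_mat M = 1\<^sub>m k"
    proof (rule eq_matI)
      fix p p' assume "p < dim_row (1\<^sub>m k :: real mat)" "p' < dim_col (1\<^sub>m k :: real mat)"
      then have p: "p < k" "p' < k" by auto
      then have "L ! p \<in> E" using set L by auto
      then obtain q where q: "q < k" "L ! p = e ! q" using idx by blast
      have "(M * transpose_mat M) $$ (p, p') =
          (\<Sum>i<k. (if L ! p = e ! i then 1 else 0) * (if L ! p' = e ! i then 1 else 0))"
        using p by (simp add: scalar_prod_def atLeast0LessThan M_def)
      also have "\<dots> = (\<Sum>i<k. if i = q then (if L ! p' = e ! q then 1 else 0) else 0)"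
      proof (rule sum.cong)
        fix i assume "i \<in> {..<k}"
        then have "e ! q = e ! i \<longleftrightarrow> i = q" using q e by (auto simp: nth_eq_iff_index_eq)
        then show "(if L ! p = e ! i then 1 else 0) * (if L ! p' = e ! i then 1 else 0) =
            (if i = q then (if L ! p' = e ! q then 1 else 0) else (0::real))"
          using q by simp
      qed simp
      also have "\<dots> = (if L ! p' = L ! p then 1 else 0)" using q by simp
      also have "\<dots> = 1\<^sub>m k $$ (p, p')"
        using p \<open>distinct L\<close> L by (auto simp: nth_eq_iff_index_eq)
      finally show "(M * transpose_mat M) $$ (p, p') = 1\<^sub>m k $$ (p, p')" .
    qed (use M in auto)
    then have "det M * det (transpose_mat M) = 1"
      using det_mult[OF M, of "transpose_mat M"] M by simp
    then show "edge_tensor E L \<noteq> 0" unfolding det by auto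
  next
    assume nz: "edge_tensor E L \<noteq> 0"
    show "set L = E"
    proof (rule ccontr)
      assume "set L \<noteq> E"
      moreover have "card (set L) \<le> card E" using assms(2) card_length[of L] by simp
      ultimately have "\<not> E \<subseteq> set L" using card_seteq[of "set L" E] by auto
      then obtain x where x: "x \<in> E" "x \<notin> set L" by blast
      then obtain q where q: "q < k" "x = e ! q" using idx by blast
      have "L ! p \<noteq> e ! q" if "p < k" for p
        using that x q L by (metis nth_mem)
      then have "M *\<^sub>v unit_vec k q = 0\<^sub>v k"
        using q M by (intro eq_vecI) (auto simp: M_def)
      then have "det M = 0"
        using det_0_iff_vec_prod_zero_field[OF M] unit_vec_carrier[of k q] unit_vec_nonzero[OF q(1)]
        by blast
      then show False using nz det by simp
    qed
  qed
qed


section \<open>Restrictions on the multilinear rank\<close>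

text \<open>An index of \<open>J\<close> outside \<open>S\<close> is swapped into the row position,
  expanded over the rows in \<open>S\<close>, and swapped back. The resulting columns have fewer
  positions outside \<open>S\<close>, which is the induction measure.\<close>

lemma row_relation_extend:
  assumes A: "antisymmetric_tensor (Suc e) n A" and S: "S \<subseteq> {..<n}"
    and rep: "\<And>i. i < n \<Longrightarrow> \<exists>c. \<forall>J\<in>tensor_indices e n. A (i # J) = (\<Sum>s\<in>S. c s * A (s # J))"
    and rel: "\<And>J. J \<in> tensor_indices e n \<Longrightarrow> set J \<subseteq> S \<Longrightarrow> (\<Sum>s\<in>S. x s * A (s # J)) = 0"
    and J: "J \<in> tensor_indices e n"
  shows "(\<Sum>s\<in>S. x s * A (s # J)) = 0"
  using J
proof (induction "card {k \<in> {..<e}. J ! k \<notin> S}" arbitrary: J rule: less_induct)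
  case less
  have len: "length J = e" using less.prems by (simp add: tensor_indices_def)
  show ?case
  proof (cases "set J \<subseteq> S")
    case True
    then show ?thesis using rel less.prems by blast
  next
    case False
    then obtain i where i: "i \<in> set J" "i \<notin> S" by blast
    then obtain k where k: "k < e" "J ! k = i" using len by (metis in_set_conv_nth)
    have Jk: "J ! k < n" using i k(2) less.prems by (auto simp: tensor_indices_def)
    have k: "k < e" "J ! k \<notin> S" using i k by auto
    have upd: "J[k := t] \<in> tensor_indices e n" if "t < n" for t
      using less.prems that by (auto simp: tensor_indices_def dest!: set_update_subset_insert[THEN subsetD])
    \<comment> \<open>Position \<open>k\<close> of the column is mode \<open>Suc k\<close> of the
      tensor, the row index being mode \<open>0\<close>.\<close>
    have swap: "A (t # J[k := s]) = - A (s # J[k := t])" if "s < n" "t < n" for s t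
    proof -
      have "s # J[k := t] \<in> tensor_indices (Suc e) n"
        using upd[OF that(2)] that(1) by (simp add: tensor_indices_def)
      from antisymmetric_tensorD[OF A this, of 0 "Suc k"] show ?thesis using k len by simp
    qed
    obtain c where c: "\<forall>L\<in>tensor_indices e n. A (J ! k # L) = (\<Sum>t\<in>S. c t * A (t # L))"
      using rep[OF Jk] by blast
    have "A (s # J) = (\<Sum>t\<in>S. c t * A (s # J[k := t]))" if s: "s \<in> S" for s
    proof -
      have sn: "s < n" using s S by auto
      have "A (s # J) = - A (J ! k # J[k := s])" using swap[OF Jk sn] by simp
      also have "\<dots> = - (\<Sum>t\<in>S. c t * A (t # J[k := s]))" using c upd[OF sn] by simp
      also have "\<dots> = (\<Sum>t\<in>S. c t * A (s # J[k := t]))"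
        unfolding sum_negf[symmetric]
      proof (rule sum.cong)
        fix t assume "t \<in> S"
        then have "A (t # J[k := s]) = - A (s # J[k := t])" using swap[OF sn, of t] S by auto
        then show "- (c t * A (t # J[k := s])) = c t * A (s # J[k := t])" by (simp only: mult_minus_right minus_minus)
      qed simp
      finally show ?thesis .
    qed
    then have "(\<Sum>s\<in>S. x s * A (s # J)) = (\<Sum>s\<in>S. \<Sum>t\<in>S. c t * (x s * A (s # J[k := t])))"
      by (simp add: sum_distrib_left mult_ac)
    also have "\<dots> = (\<Sum>t\<in>S. c t * (\<Sum>s\<in>S. x s * A (s # J[k := t])))"
      by (subst sum.swap) (simp add: sum_distrib_left)
    also have "\<dots> = 0"
    proof (intro sum.neutral ballI)
      fix t assume t: "t \<in> S"
      have "{l \<in> {..<e}. J[k := t] ! l \<notin> S} \<subseteq> {l \<in> {..<e}. J ! l \<notin> S} - {k}"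
        using t len k by (auto simp: nth_list_update)
      then have "card {l \<in> {..<e}. J[k := t] ! l \<notin> S} < card {l \<in> {..<e}. J ! l \<notin> S}"
        using k by (intro psubset_card_mono) auto
      then have "(\<Sum>s\<in>S. x s * A (s # J[k := t])) = 0"
        using less.hyps upd t S by blast
      then show "c t * (\<Sum>s\<in>S. x s * A (s # J[k := t])) = 0" by simp
    qed
    finally show ?thesis .
  qed
qed

text \<open>As \<open>card S\<close> exceeds the order by one, an entry with distinct indices in
  \<open>S\<close> is determined up to sign by the single element it omits.\<close>

lemma row_relation_card_succ:
  assumes A: "antisymmetric_tensor (Suc e) n A" and S: "S \<subseteq> {..<n}" "card S = Suc (Suc e)"
  obtains x where "\<exists>s\<in>S. x s \<noteq> 0"
    "\<And>J. J \<in> tensor_indices e n \<Longrightarrow> set J \<subseteq> S \<Longrightarrow> (\<Sum>s\<in>S. x s * A (s # J)) = 0"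
proof -
  have fin: "finite S" using S by (simp add: finite_subset)
  define L where "L y = sorted_list_of_set (S - {y})" for y
  have L: "set (L y) = S - {y}" "distinct (L y)" "L y \<in> tensor_indices (Suc e) n" if "y \<in> S" for y
    using that fin S by (auto simp: L_def tensor_indices_def)
  have zero: "A (s # J) = 0"
    if "s \<in> S" "J \<in> tensor_indices e n" "set J \<subseteq> S" "\<not> distinct (s # J)" for s J
    using antisymmetric_tensor_not_distinct[OF A] that S by (auto simp: tensor_indices_def)
  show thesis
  proof (cases "\<exists>y\<in>S. A (L y) \<noteq> 0")
    case False
    \<comment> \<open>The Hodge dual vanishes in this case, but then so do all entries over
      \<open>S\<close>, and any weights give a relation.\<close>
    have "A (s # J) = 0" if sJ: "s \<in> S" "J \<in> tensor_indices e n" "set J \<subseteq> S" for s J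
    proof (cases "distinct (s # J)")
      case True
      have "card (set (s # J)) = Suc e" using True sJ by (simp add: tensor_indices_def distinct_card)
      then have "card (S - set (s # J)) = 1" using sJ S fin by (subst card_Diff_subset) auto
      then obtain y where y: "S - set (s # J) = {y}" by (auto simp: card_1_singleton_iff)
      then have "y \<in> S" "set (s # J) = S - {y}" using sJ by auto
      with L[of y] obtain c where "A (s # J) = c * A (L y)"
        using antisymmetric_tensor_reorder[of "L y" "Suc e" n "s # J"] True A by metis
      then show ?thesis using False \<open>y \<in> S\<close> by simp
    qed (use zero sJ in blast)
    moreover have "S \<noteq> {}" using S by auto
    ultimately show thesis by (intro that[of "\<lambda>_. 1"]) auto
  next
    case True
    let ?\<epsilon> = "edge_tensor S"
    \<comment> \<open>The components of the Hodge dual, with \<open>edge_tensor S\<close> as the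
      alternating symbol.\<close>
    define x where "x y = ?\<epsilon> (y # L y) * A (L y)" for y
    have \<epsilon>: "antisymmetric_tensor (Suc (Suc e)) n ?\<epsilon>"
      using antisymmetric_edge_tensor[of S n] S by simp
    \<comment> \<open>The weight does not depend on the chosen enumeration, since both factors change by the same sign.\<close>
    have x: "x y = ?\<epsilon> (y # K) * A K" if yK: "y \<in> S" "distinct K" "set K = S - {y}" for y K
    proof -
      obtain c where c: "c * c = 1" "\<And>B. antisymmetric_tensor (Suc e) n B \<Longrightarrow> B K = c * B (L y)"
        using antisymmetric_tensor_reorder[OF L(3)[OF yK(1)] L(2)[OF yK(1)] yK(2)] L(1)[OF yK(1)] yK(3)
        by auto
      have "?\<epsilon> (y # K) = c * ?\<epsilon> (y # L y)"
        using c(2)[OF antisymmetric_tensor_Cons[OF \<epsilon>, of y]] yK(1) S by auto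
      moreover have "A K = c * A (L y)" by (rule c(2)[OF A])
      ultimately have "?\<epsilon> (y # K) * A K = (c * c) * x y" by (simp add: x_def mult_ac)
      then show ?thesis using c(1) by simp
    qed
    have nz: "\<exists>s\<in>S. x s \<noteq> 0"
    proof -
      obtain y where y: "y \<in> S" "A (L y) \<noteq> 0" using True by blast
      have "set (y # L y) = S" "length (y # L y) = card S"
        using L[OF y(1)] y(1) S by (auto simp: tensor_indices_def)
      then have "?\<epsilon> (y # L y) \<noteq> 0" using edge_tensor_nonzero_iff[OF fin] by blast
      then show ?thesis using y by (auto simp: x_def)
    qed
    have rel: "(\<Sum>s\<in>S. x s * A (s # J)) = 0" if J: "J \<in> tensor_indices e n" "set J \<subseteq> S" for J
    proof (cases "distinct J")
      case False
      then show ?thesis using zero J by (intro sum.neutral) auto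
    next
      case True
      then have "card (set J) = e" using J by (simp add: tensor_indices_def distinct_card)
      then have "card (S - set J) = 2" using J S fin by (subst card_Diff_subset) auto
      then obtain y z where yz: "S - set J = {y, z}" "y \<noteq> z" by (auto simp: card_2_iff)
      \<comment> \<open>The enumerations \<open>z # J\<close> and \<open>y # J\<close> are chosen so
        that the two symbols differ by one swap of the leading indices.\<close>
      have "x y = ?\<epsilon> (y # z # J) * A (z # J)" "x z = ?\<epsilon> (z # y # J) * A (y # J)"
        using True yz J by (auto intro!: x)
      moreover have "?\<epsilon> (z # y # J) = - ?\<epsilon> (y # z # J)"
      proof -
        have "y # z # J \<in> tensor_indices (Suc (Suc e)) n"
          using J yz S by (auto simp: tensor_indices_def)
        from antisymmetric_tensorD[OF \<epsilon> this, of 0 "Suc 0"] show ?thesis by simp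
      qed
      \<comment> \<open>Any other \<open>s\<close> in \<open>S\<close> already occurs in
        \<open>J\<close>, so its term has a repeated index.\<close>
      moreover have "(\<Sum>s\<in>S. x s * A (s # J)) = (\<Sum>s\<in>{y, z}. x s * A (s # J))"
        using yz(1) fin J zero by (intro sum.mono_neutral_right) auto
      ultimately show ?thesis using yz(2) by simp
    qed
    show thesis using that nz rel by blast
  qed
qed

lemma multilinear_rank_cases:
  assumes d: "d \<ge> 2" and A: "antisymmetric_tensor d n A"
  shows "multilinear_rank d n A = 0 \<or> multilinear_rank d n A = d \<or>
     (d + 2 \<le> multilinear_rank d n A \<and> multilinear_rank d n A \<le> n)"
proof -
  obtain e where e: "d = Suc e" using d by (cases d) auto
  obtain S where S: "row_basis n (tensor_indices e n) (\<lambda>i J. A (i # J)) S"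
    using row_basis_exists by blast
  then have r: "multilinear_rank d n A = card S" using card_tensor_row_basis[of n d A S] e by simp
  have sub: "S \<subseteq> {..<n}" and fin: "finite S"
    and indep: "\<And>x. \<forall>J\<in>tensor_indices e n. (\<Sum>s\<in>S. x s * A (s # J)) = 0 \<Longrightarrow> \<forall>s\<in>S. x s = 0"
    and rep: "\<And>i. i < n \<Longrightarrow> \<exists>c. \<forall>J\<in>tensor_indices e n. A (i # J) = (\<Sum>s\<in>S. c s * A (s # J))"
    using S finite_subset[of S "{..<n}"] unfolding row_basis_def by simp_all
  have indep': "\<forall>s\<in>S. x s = 0"
    if "\<And>J. J \<in> tensor_indices e n \<Longrightarrow> set J \<subseteq> S \<Longrightarrow> (\<Sum>s\<in>S. x s * A (s # J)) = 0" for x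
    using row_relation_extend[OF A[unfolded e] sub rep that] indep by blast
  have "S = {}" if "card S < d"
  proof -
    have "A (s # J) = 0" if "s \<in> S" "J \<in> tensor_indices e n" "set J \<subseteq> S" for s J
    proof (rule antisymmetric_tensor_not_distinct[OF A])
      show "s # J \<in> tensor_indices d n" using that sub e by (auto simp: tensor_indices_def)
      show "\<not> distinct (s # J)"
      proof
        assume "distinct (s # J)"
        then have "card (set (s # J)) = d" using that e distinct_card[of "s # J"] by (simp add: tensor_indices_def)
        moreover have "card (set (s # J)) \<le> card S" using that fin by (intro card_mono) auto
        ultimately show False using \<open>card S < d\<close> by simp
      qed
    qed
    \<comment> \<open>All entries over \<open>S\<close> vanish, so even the constant weight
      \<open>1\<close> is a relation; independence leaves only the empty set.\<close>
    then have "\<forall>s\<in>S. (1::real) = 0" using indep'[of "\<lambda>_. 1"] by simp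
    then show ?thesis by auto
  qed
  moreover have "card S \<noteq> Suc d"
  proof
    assume "card S = Suc d"
    then have "card S = Suc (Suc e)" using e by simp
    from row_relation_card_succ[OF A[unfolded e] sub this] obtain x where
      "\<exists>s\<in>S. x s \<noteq> 0" "\<And>J. J \<in> tensor_indices e n \<Longrightarrow> set J \<subseteq> S \<Longrightarrow> (\<Sum>s\<in>S. x s * A (s # J)) = 0"
      by blast
    then show False using indep'[of x] by blast
  qed
  moreover have "card S \<le> n" using card_mono[OF finite_lessThan sub] by simp
  ultimately show ?thesis unfolding r by (cases "card S < d") auto
qed


section \<open>Set families and tensors attaining the admissible ranks\<close>

text \<open>The bound on intersections says that no set of \<open>d - 1\<close> elements lies in two
  members, so a column of the tensor built from \<open>F\<close> can single out one row.\<close>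

definition separated_edges :: "nat \<Rightarrow> nat \<Rightarrow> nat set set \<Rightarrow> bool" where
  "separated_edges d r F \<longleftrightarrow> \<Union> F = {..<r} \<and> (\<forall>E\<in>F. card E = d) \<and>
     (\<forall>E\<in>F. \<forall>E'\<in>F. E \<noteq> E' \<longrightarrow> card (E \<inter> E') + 2 \<le> d)"

text \<open>The added set reuses \<open>d - k\<close> old elements, at most \<open>d - 2\<close>
  since \<open>k\<close> is at least \<open>2\<close>, so its intersections with old members are
  small enough.\<close>

lemma separated_edges_extend:
  assumes F: "separated_edges d r F" and k: "2 \<le> k" "k \<le> d" "d \<le> r + k"
  shows "\<exists>F. separated_edges d (r + k) F"
proof -
  define E0 where "E0 = {..<d - k} \<union> {r..<r + k}"
  have disj: "{..<d - k} \<inter> {r..<r + k} = {}" using k by auto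
  have card: "card E0 = d" unfolding E0_def using k by (subst card_Un_disjoint[OF _ _ disj]) auto
  have meet: "card (E0 \<inter> E) + 2 \<le> d" if "E \<in> F" for E
  proof -
    have "E \<subseteq> {..<r}" using F that unfolding separated_edges_def by blast
    then have "E0 \<inter> E \<subseteq> {..<d - k}" by (auto simp: E0_def)
    then have "card (E0 \<inter> E) \<le> d - k" using card_mono[OF finite_lessThan] by fastforce
    then show ?thesis using k by simp
  qed
  have "\<Union> (insert E0 F) = {..<r + k}" using F k by (auto simp: E0_def separated_edges_def)
  then have "separated_edges d (r + k) (insert E0 F)"
    using F card meet unfolding separated_edges_def by (auto simp: Int_commute)
  then show ?thesis by blast
qed

lemma separated_edges_exists:
  assumes "d \<ge> 2" "r = 0 \<or> r = d \<or> d + 2 \<le> r" "d = 2 \<longrightarrow> even r"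
  shows "\<exists>F. separated_edges d r F"
  using assms(2,3)
proof (induction r rule: less_induct)
  case (less r)
  have 0: "separated_edges d 0 {}" by (simp add: separated_edges_def)
  have d: "\<exists>F. separated_edges d d F" using separated_edges_extend[OF 0, of d] assms(1) by simp
  \<comment> \<open>Going back by \<open>2\<close> from \<open>d + 3\<close> would hit the forbidden
    size \<open>d + 1\<close>, so that size is built from \<open>d\<close> with three new elements.
    For \<open>d = 2\<close> it equals \<open>5\<close>, which parity excludes.\<close>
  consider "r = 0" | "r = d" | "r = d + 3" "d \<ge> 3" | "d + 2 \<le> r" "r \<noteq> d + 3"
    using less.prems assms(1) by (cases "d = 2"; cases "r = 5") auto
  then show ?case
  proof cases
    case 1
    then show ?thesis using 0 by blast
  next
    case 2
    then show ?thesis using d by simp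
  next
    case 3
    then show ?thesis using d separated_edges_extend[of d d _ 3] by auto
  next
    case 4
    then have "r - 2 < r" "r - 2 = 0 \<or> r - 2 = d \<or> d + 2 \<le> r - 2" "d = 2 \<longrightarrow> even (r - 2)"
      using less.prems assms(1) by auto
    then obtain F where "separated_edges d (r - 2) F" using less.IH by blast
    moreover have "d \<le> r - 2 + 2" "r - 2 + 2 = r" using 4 by auto
    ultimately show ?thesis using separated_edges_extend[of d "r - 2" F 2] assms(1) by (metis order_refl)
  qed
qed

lemma antisymmetric_tensor_sum:
  assumes "\<And>E. E \<in> F \<Longrightarrow> antisymmetric_tensor d n (B E)"
  shows "antisymmetric_tensor d n (\<lambda>L. \<Sum>E\<in>F. B E L)"
  using assms by (simp add: antisymmetric_tensor_def flip: sum_negf)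

text \<open>The rows below \<open>r\<close> form a row basis: each has a column in which it alone is
  nonzero, and the rows from \<open>r\<close> on vanish.\<close>

lemma separated_edges_tensor:
  assumes F: "separated_edges d r F" and d: "d \<ge> 2" and r: "r \<le> n"
  shows "\<exists>A. antisymmetric_tensor d n A \<and> multilinear_rank d n A = r"
proof -
  define A where "A L = (\<Sum>E\<in>F. edge_tensor E L)" for L
  have un: "\<Union> F = {..<r}" and card: "\<And>E. E \<in> F \<Longrightarrow> card E = d"
    and sep: "\<And>E E'. E \<in> F \<Longrightarrow> E' \<in> F \<Longrightarrow> E \<noteq> E' \<Longrightarrow> card (E \<inter> E') + 2 \<le> d"
    using F by (auto simp: separated_edges_def)
  have finF: "finite F" using un by (metis finite_UnionD finite_lessThan)
  have fin: "finite E" "E \<subseteq> {..<r}" if "E \<in> F" for E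
    using that un by (auto intro: finite_subset[of E "{..<r}"])
  have anti: "antisymmetric_tensor d n A"
    unfolding A_def using card antisymmetric_edge_tensor by (intro antisymmetric_tensor_sum) metis
  have edge: "edge_tensor E L \<noteq> 0 \<longleftrightarrow> set L = E" if "E \<in> F" "length L = d" for E L
    using edge_tensor_nonzero_iff[OF fin(1)[OF that(1)]] that card by simp
  have zero: "A L = 0" if "length L = d" "set L \<notin> F" for L
    unfolding A_def using edge that by (intro sum.neutral) auto
  have "row_basis n (tensor_indices (d - 1) n) (\<lambda>i J. A (i # J)) {..<r}"
    unfolding row_basis_def
  proof (intro conjI allI impI ballI)
    show "{..<r} \<subseteq> {..<n}" using r by auto
  next
    fix x s
    assume rel: "\<forall>J\<in>tensor_indices (d - 1) n. (\<Sum>s\<in>{..<r}. x s * A (s # J)) = 0" and s: "s \<in> {..<r}"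
    then obtain E where E: "E \<in> F" "s \<in> E" using un by blast
    \<comment> \<open>The column that isolates row \<open>s\<close>: a member containing
      \<open>s\<close>, with \<open>s\<close> removed.\<close>
    define J where "J = sorted_list_of_set (E - {s})"
    have setJ: "set J = E - {s}" using fin[OF E(1)] by (simp add: J_def)
    have lenJ: "length J = d - 1" using fin[OF E(1)] E card by (simp add: J_def)
    have J: "J \<in> tensor_indices (d - 1) n"
      using setJ lenJ fin[OF E(1)] r by (auto simp: tensor_indices_def)
    have sJ: "set (s # J) = E" using setJ E by auto
    have "A (s # J) = edge_tensor E (s # J) + (\<Sum>E'\<in>F - {E}. edge_tensor E' (s # J))"
      unfolding A_def using finF E by (simp add: sum.remove)
    also have "(\<Sum>E'\<in>F - {E}. edge_tensor E' (s # J)) = 0"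
      using edge[of _ "s # J"] sJ lenJ d by (intro sum.neutral) auto
    finally have nz: "A (s # J) \<noteq> 0" using edge[of E "s # J"] sJ lenJ d E by simp
    have "A (t # J) = 0" if "t \<noteq> s" for t
    proof (rule zero)
      show "length (t # J) = d" using lenJ d by simp
      show "set (t # J) \<notin> F"
      proof
        \<comment> \<open>This would be a second member sharing with \<open>E\<close> the
          \<open>d - 1\<close> elements of \<open>E - {s}\<close>.\<close>
        assume tJ: "set (t # J) \<in> F"
        have "s \<notin> set (t # J)" using setJ that by auto
        then have "card (E \<inter> set (t # J)) + 2 \<le> d" using sep[OF E(1) tJ] E(2) by blast
        moreover have "card (E - {s}) \<le> card (E \<inter> set (t # J))"
          using setJ fin[OF E(1)] by (intro card_mono) auto
        ultimately show False using card[OF E(1)] E(2) fin[OF E(1)] d by simp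
      qed
    qed
    then have "(\<Sum>t\<in>{..<r}. x t * A (t # J)) = (\<Sum>t\<in>{s}. x t * A (t # J))"
      using s by (intro sum.mono_neutral_right) auto
    then show "x s = 0" using rel J nz by simp
  next
    fix i assume "i < n"
    show "\<exists>c. \<forall>J\<in>tensor_indices (d - 1) n. A (i # J) = (\<Sum>s\<in>{..<r}. c s * A (s # J))"
    proof (cases "i < r")
      case True
      then show ?thesis
        by (intro exI[of _ "\<lambda>s. if s = i then 1 else 0"]) (simp add: if_distrib[of "\<lambda>z. z * _"] cong: if_cong)
    next
      case False
      have "A (i # J) = 0" if "J \<in> tensor_indices (d - 1) n" for J
        using that False d un by (intro zero) (auto simp: tensor_indices_def)
      then show ?thesis by (intro exI[of _ "\<lambda>_. 0"]) simp
    qed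
  qed
  from card_tensor_row_basis[OF this] anti show ?thesis by auto
qed

text \<open>Attainability carries a parity condition for \<open>d = 2\<close>, because an
  antisymmetric matrix has even rank; rank \<open>d\<close> moreover requires
  \<open>d \<le> n\<close>.\<close>

theorem corollary2p3:
  fixes d n :: nat
  assumes "d \<ge> 2"
  shows "(\<forall>A. antisymmetric_tensor d n A \<longrightarrow>
            multilinear_rank d n A = 0 \<or> multilinear_rank d n A = d \<or>
            (d + 2 \<le> multilinear_rank d n A \<and> multilinear_rank d n A \<le> n))
       \<and> (\<forall>r. (r = 0 \<or> (r = d \<and> d \<le> n) \<or> (d + 2 \<le> r \<and> r \<le> n)) \<and> (d = 2 \<longrightarrow> even r) \<longrightarrow>
            (\<exists>A. antisymmetric_tensor d n A \<and> multilinear_rank d n A = r))"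
proof (intro conjI allI impI)
  fix A assume "antisymmetric_tensor d n A"
  then show "multilinear_rank d n A = 0 \<or> multilinear_rank d n A = d \<or>
      (d + 2 \<le> multilinear_rank d n A \<and> multilinear_rank d n A \<le> n)"
    by (rule multilinear_rank_cases[OF assms])
next
  fix r assume r: "(r = 0 \<or> (r = d \<and> d \<le> n) \<or> (d + 2 \<le> r \<and> r \<le> n)) \<and> (d = 2 \<longrightarrow> even r)"
  then obtain F where "separated_edges d r F" using separated_edges_exists[OF assms, of r] by blast
  then show "\<exists>A. antisymmetric_tensor d n A \<and> multilinear_rank d n A = r"
    using r assms by (intro separated_edges_tensor) auto
qed

end
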